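(* Let $K\subseteq L^0$ be a wedge and let $\Phi:[0,\infty)\to(-\infty,\infty]$ be a convex function which may take the value $\infty$ only at $0$. Let $X\in E_\Phi$ and assume that $\Phi$ satisfies the growth condition and $M_\Phi\neq\emptyset$. Then $$\overline\pi(X;C_\Phi)=\sup_{\mathbb Q\in M_\Phi}\mathbb E_{\mathbb Q}[X].$$
   Context: $(\Omega,\mathcal F,\mathbb P)$ is a probability space and $L^0=L^0(\Omega,\mathcal F,\mathbb P)$ is the vector lattice of real random variables modulo $\mathbb P$-a.s. equality, ordered $\mathbb P$-a.s. For a probability measure $\mathbb Q\ll\mathbb P$, $L^1(\mathbb Q)$ is regarded as the set of $X\in L^0$ with $\mathbb E_{\mathbb Q}|X|<\infty$, and $L^1_+(\mathbb Q)$ is its subset of non-negative elements. A wedge in a real vector space is a non-empty convex set $C$ with $\lambda C\subseteq C$ for all $\lambda\ge0$. $M_1=M_1(\mathbb P;K)$ is the set of all probability measures $\mathbb Q\ll\mathbb P$ such that $K\subseteq L^1(\mathbb Q)$ and $\mathbb E_{\mathbb Q}[X]\le0$ for all $X\in K$. With $\Phi^+=\max\{\Phi,0\}$: $M_\Phi=\{\mathbb Q\in M_1:\mathbb E_{\mathbb P}[\Phi^+(\frac{d\mathbb Q}{d\mathbb P})]<\infty\}$, and $E_\Phi:=\bigcap_{\mathbb Q\in M_\Phi}L^1(\mathbb Q)$. Growth condition on $\Phi$: for every interval $[\lambda_0,\lambda_1]\subseteq(0,\infty)$ there exist $\alpha>0$, $\beta>0$ such that $\Phi^+(\lambda y)\le\alpha\Phi^+(y)+\beta(y+1)$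 for all $y>0$ and all $\lambda\in[\lambda_0,\lambda_1]$. $C_\Phi:=\bigcap_{\mathbb Q\in M_\Phi}\overline{K-L^1_+(\mathbb Q)}^{L^1(\mathbb Q)}\subseteq E_\Phi$, where the closure consists of all $X\in L^1(\mathbb Q)$ for which there are $X_n\in K-L^1_+(\mathbb Q)$ with $\mathbb E_{\mathbb Q}|X-X_n|\to0$. For $X\in E_\Phi$: $\overline\pi(X;C_\Phi):=\inf\{x\in\mathbb R:X\le x+G\text{ for some }G\in C_\Phi\}$, with the convention $\inf\emptyset=+\infty$. *)

theory Defs
  imports "HOL-Probability.Probability"
begin

text \<open>
  Subsets of \<open>L\<^sup>0(P)\<close> are represented by sets of measurable functions that are closed under
  \<open>P\<close>-a.s. equality, i.e. by the unions of the corresponding equivalence classes. Elements of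
  \<open>L\<^sup>0(P)\<close> are represented by arbitrary measurable functions.
\<close>

definition L0_subset :: "'a measure \<Rightarrow> ('a \<Rightarrow> real) set \<Rightarrow> bool" where
  "L0_subset P C \<longleftrightarrow> C \<subseteq> borel_measurable P \<and>
     (\<forall>X\<in>C. \<forall>Y\<in>borel_measurable P. (AE \<omega> in P. X \<omega> = Y \<omega>) \<longrightarrow> Y \<in> C)"

definition wedge_L0 :: "'a measure \<Rightarrow> ('a \<Rightarrow> real) set \<Rightarrow> bool" where
  "wedge_L0 P C \<longleftrightarrow> L0_subset P C \<and> C \<noteq> {} \<and>
     (\<forall>X\<in>C. \<forall>Y\<in>C. \<forall>t\<in>{0..1}. (\<lambda>\<omega>. (1 - t) * X \<omega> + t * Y \<omega>) \<in> C) \<and>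
     (\<forall>X\<in>C. \<forall>c\<ge>0. (\<lambda>\<omega>. c * X \<omega>) \<in> C)"

definition L1 :: "'a measure \<Rightarrow> 'a measure \<Rightarrow> ('a \<Rightarrow> real) set" where
  "L1 P Q = {X \<in> borel_measurable P. integrable Q X}"

text \<open>Non-negativity refers to the order of \<open>L\<^sup>0(P)\<close>, hence holds \<open>P\<close>-a.s. (not just \<open>Q\<close>-a.s.).\<close>

definition L1_plus :: "'a measure \<Rightarrow> 'a measure \<Rightarrow> ('a \<Rightarrow> real) set" where
  "L1_plus P Q = {X \<in> L1 P Q. AE \<omega> in P. 0 \<le> X \<omega>}"

definition M1 :: "'a measure \<Rightarrow> ('a \<Rightarrow> real) set \<Rightarrow> 'a measure set" where
  "M1 P K = {Q. prob_space Q \<and> sets Q = sets P \<and> absolutely_continuous P Q \<and>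
     K \<subseteq> L1 P Q \<and> (\<forall>X\<in>K. (\<integral>\<omega>. X \<omega> \<partial>Q) \<le> 0)}"

text \<open>
  A function \<open>\<Phi>\<close> from \<open>[0,\<infinity>)\<close> to \<open>(-\<infinity>,\<infinity>]\<close> is represented by \<open>\<Phi> :: real \<Rightarrow> ereal\<close>; its values at
  negative arguments are never used. In the convexity inequality \<open>0 * \<infinity> = 0\<close>.
\<close>

definition convex_Phi :: "(real \<Rightarrow> ereal) \<Rightarrow> bool" where
  "convex_Phi \<Phi> \<longleftrightarrow> (\<forall>y\<ge>0. \<Phi> y \<noteq> -\<infinity>) \<and> (\<forall>y>0. \<Phi> y \<noteq> \<infinity>) \<and>
     (\<forall>x\<ge>0. \<forall>y\<ge>0. \<forall>t\<in>{0..1}.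
        \<Phi> ((1 - t) * x + t * y) \<le> ereal (1 - t) * \<Phi> x + ereal t * \<Phi> y)"

definition Phi_plus :: "(real \<Rightarrow> ereal) \<Rightarrow> real \<Rightarrow> ereal" where
  "Phi_plus \<Phi> y = max (\<Phi> y) 0"

definition growth_condition :: "(real \<Rightarrow> ereal) \<Rightarrow> bool" where
  "growth_condition \<Phi> \<longleftrightarrow>
     (\<forall>l0 l1. 0 < l0 \<and> l0 \<le> l1 \<longrightarrow>
        (\<exists>\<alpha>>0. \<exists>\<beta>>0. \<forall>y>0. \<forall>l\<in>{l0..l1}.
           Phi_plus \<Phi> (l * y) \<le> ereal \<alpha> * Phi_plus \<Phi> y + ereal (\<beta> * (y + 1))))"

text \<open>The density \<open>RN_deriv P Q\<close> is \<open>ennreal\<close>-valued, but \<open>P\<close>-a.s. finite for probability measures \<open>Q\<close>.\<close>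

definition M_Phi :: "'a measure \<Rightarrow> ('a \<Rightarrow> real) set \<Rightarrow> (real \<Rightarrow> ereal) \<Rightarrow> 'a measure set" where
  "M_Phi P K \<Phi> = {Q \<in> M1 P K.
     (\<integral>\<^sup>+ \<omega>. e2ennreal (Phi_plus \<Phi> (enn2real (RN_deriv P Q \<omega>))) \<partial>P) < \<infinity>}"

definition E_Phi :: "'a measure \<Rightarrow> ('a \<Rightarrow> real) set \<Rightarrow> (real \<Rightarrow> ereal) \<Rightarrow> ('a \<Rightarrow> real) set" where
  "E_Phi P K \<Phi> = (\<Inter>Q\<in>M_Phi P K \<Phi>. L1 P Q)"

definition K_minus_L1_plus :: "'a measure \<Rightarrow> ('a \<Rightarrow> real) set \<Rightarrow> 'a measure \<Rightarrow> ('a \<Rightarrow> real) set" where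
  "K_minus_L1_plus P K Q = {\<lambda>\<omega>. Y \<omega> - Z \<omega> | Y Z. Y \<in> K \<and> Z \<in> L1_plus P Q}"

definition L1_closure :: "'a measure \<Rightarrow> 'a measure \<Rightarrow> ('a \<Rightarrow> real) set \<Rightarrow> ('a \<Rightarrow> real) set" where
  "L1_closure P Q C = {X \<in> L1 P Q. \<exists>Xs :: nat \<Rightarrow> 'a \<Rightarrow> real. (\<forall>n. Xs n \<in> C) \<and>
     (\<lambda>n. \<integral>\<^sup>+ \<omega>. ennreal \<bar>X \<omega> - Xs n \<omega>\<bar> \<partial>Q) \<longlonglongrightarrow> 0}"

definition C_Phi :: "'a measure \<Rightarrow> ('a \<Rightarrow> real) set \<Rightarrow> (real \<Rightarrow> ereal) \<Rightarrow> ('a \<Rightarrow> real) set" where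
  "C_Phi P K \<Phi> = (\<Inter>Q\<in>M_Phi P K \<Phi>. L1_closure P Q (K_minus_L1_plus P K Q))"

text \<open>The infimum is taken in \<open>ereal\<close>, where \<open>Inf {} = \<infinity>\<close>.\<close>

definition superhedging_price :: "'a measure \<Rightarrow> ('a \<Rightarrow> real) set \<Rightarrow> ('a \<Rightarrow> real) \<Rightarrow> ereal" where
  "superhedging_price P C X = Inf {ereal x | x. \<exists>G\<in>C. AE \<omega> in P. X \<omega> \<le> x + G \<omega>}"

end

theory Submission
  imports Defs
begin

text \<open>
  The inequality \<open>\<ge>\<close> holds because \<open>E\<^sub>Q G \<le> 0\<close> for \<open>G\<close> in the \<open>L\<^sup>1(Q)\<close>-closure of
  \<open>K - L\<^sup>1\<^sub>+(Q)\<close>. For \<open>\<le>\<close>, let \<open>Y = X - s\<close> where \<open>s\<close> is the supremum, and suppose that \<open>Y\<close> is not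
  in this closure for some \<open>Q\<close>. Separation in \<open>L\<^sup>1(Q)\<close> gives a bounded \<open>Z\<close>, necessarily
  non-negative, with \<open>E\<^sub>Q (Z V) \<le> 0\<close> on the cone and \<open>E\<^sub>Q (Z Y) > 0\<close>. For small \<open>\<epsilon> > 0\<close> the
  normalised density \<open>Z + \<epsilon>\<close> still prices \<open>Y\<close> positively; being bounded and bounded away from
  \<open>0\<close>, it defines an element of \<open>M_Phi\<close> by the growth condition, contradicting the choice of \<open>s\<close>.

  The separating \<open>Z\<close> is obtained without the Hahn-Banach theorem: minimise \<open>E (huber (Y - W))\<close>
  over the cone. Along a minimising sequence \<open>W\<^sub>n\<close> the derivatives \<open>unit_clamp (Y - W\<^sub>n)\<close> form a
  Cauchy sequence in \<open>L\<^sup>2\<close>, although \<open>W\<^sub>n\<close> itself need not converge; their limit is \<open>Z\<close>.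
\<close>

section \<open>The Huber function and its derivative\<close>

definition unit_clamp :: "real \<Rightarrow> real" where
  "unit_clamp x = max (- 1) (min 1 x)"

text \<open>The Huber loss, equal to x^2/2 on [-1,1] and to |x| - 1/2 outside. It is written through
  its derivative \<open>unit_clamp\<close>, so that case distinctions are confined to the clamp. Its
  linear growth keeps it integrable on L1, and its slope is bounded.\<close>

definition huber :: "real \<Rightarrow> real" where
  "huber x = unit_clamp x * x - (unit_clamp x)\<^sup>2 / 2"

lemma unit_clamp_measurable [measurable]: "unit_clamp \<in> borel_measurable borel"
  unfolding unit_clamp_def by measurable

lemma huber_measurable [measurable]: "huber \<in> borel_measurable borel"
  unfolding huber_def by measurable

lemma abs_unit_clamp_le: "\<bar>unit_clamp x\<bar> \<le> 1"
  by (auto simp: unit_clamp_def)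

lemma unit_clamp_diff_le: "\<bar>unit_clamp a - unit_clamp b\<bar> \<le> \<bar>a - b\<bar>"
  by (auto simp: unit_clamp_def)

text \<open>The gap between the two sides is exactly
  \<open>(unit_clamp b - unit_clamp a) * (b - unit_clamp b)\<close>. The second factor vanishes
  unless b lies outside [-1,1], and then \<open>unit_clamp b\<close> is the extreme value of the
  same sign. The quadratic surplus over plain convexity later controls the distance between
  derivatives.\<close>

lemma huber_ge_tangent:
  "huber a + unit_clamp a * (b - a) + (unit_clamp b - unit_clamp a)\<^sup>2 / 2 \<le> huber b"
proof -
  have "0 \<le> (unit_clamp b - unit_clamp a) * (b - unit_clamp b)"
    by (auto simp: unit_clamp_def max_def min_def mult_nonpos_nonpos)
  then show ?thesis
    by (simp add: huber_def power2_eq_square field_simps)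
qed

lemma huber_ge_tangent_line: "huber a + unit_clamp a * (b - a) \<le> huber b"
  using huber_ge_tangent[of a b] zero_le_power2[of "unit_clamp b - unit_clamp a"] by linarith

lemma huber_nonneg: "0 \<le> huber x"
  using huber_ge_tangent_line[of 0 x] by (simp add: huber_def[of 0] unit_clamp_def[of 0])

lemma huber_le_abs: "huber x \<le> \<bar>x\<bar>"
proof -
  have "huber x \<le> unit_clamp x * x"
    using huber_ge_tangent_line[of x 0] by (simp add: huber_def[of 0] unit_clamp_def[of 0])
  also have "\<dots> \<le> \<bar>unit_clamp x\<bar> * \<bar>x\<bar>"
    by (simp flip: abs_mult)
  also have "\<dots> \<le> 1 * \<bar>x\<bar>"
    by (intro mult_right_mono abs_unit_clamp_le) simp
  finally show ?thesis by simp
qed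

text \<open>Near-minimisers have nearby derivatives: the tangent inequalities at the midpoint,
  towards a and towards b, are added, and their linear terms cancel.\<close>

lemma huber_midpoint:
  "(unit_clamp a - unit_clamp b)\<^sup>2 \<le> 4 * (huber a + huber b - 2 * huber ((a + b) / 2))"
proof -
  let ?m = "(a + b) / 2"
  have "huber ?m + unit_clamp ?m * (a - ?m) + (unit_clamp a - unit_clamp ?m)\<^sup>2 / 2
      + (huber ?m + unit_clamp ?m * (b - ?m) + (unit_clamp b - unit_clamp ?m)\<^sup>2 / 2)
      \<le> huber a + huber b"
    by (intro add_mono huber_ge_tangent)
  moreover have "unit_clamp ?m * (a - ?m) + unit_clamp ?m * (b - ?m) = 0"
    by (simp add: field_simps)
  moreover have "(p - q)\<^sup>2 \<le> 2 * (p - r)\<^sup>2 + 2 * (q - r)\<^sup>2" for p q r :: real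
    using zero_le_power2[of "p + q - 2 * r"] by (simp add: power2_eq_square algebra_simps)
  from this[of "unit_clamp a" "unit_clamp b" "unit_clamp ?m"] 
  have "(unit_clamp a - unit_clamp b)\<^sup>2
      \<le> 2 * (unit_clamp a - unit_clamp ?m)\<^sup>2 + 2 * (unit_clamp b - unit_clamp ?m)\<^sup>2" .
  \<comment> \<open>With the nonlinear terms replaced by variables, only linear arithmetic is
    left.\<close>
  moreover have "d \<le> 4 * (A + B - 2 * h)"
    if "h + u + p / 2 + (h + v + q / 2) \<le> A + B" "u + v = 0" "d \<le> 2 * p + 2 * q"
    for A B d h p q u v :: real
    using that by argo
  ultimately show ?thesis
    by blast
qed

text \<open>The tangent is taken at the new point, and the change of slope is bounded in two ways:
  by t|v| since the clamp is 1-Lipschitz, and by 2 since it is bounded. The first bound makes the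
  error small for small t, the second keeps it integrable for v merely in L1.\<close>

lemma huber_diff_le:
  assumes "0 \<le> t"
  shows "huber (a - t * v) \<le> huber a - t * (unit_clamp a * v) + t * min (t * v\<^sup>2) (2 * \<bar>v\<bar>)"
proof -
  let ?b = "a - t * v"
  have "huber ?b + unit_clamp ?b * (a - ?b) \<le> huber a"
    by (rule huber_ge_tangent_line)
  then have "huber ?b \<le> huber a - t * (unit_clamp a * v) + (unit_clamp ?b - unit_clamp a) * (- (t * v))"
    by (simp add: algebra_simps)
  moreover have "(unit_clamp ?b - unit_clamp a) * (- (t * v)) \<le> \<bar>unit_clamp ?b - unit_clamp a\<bar> * (t * \<bar>v\<bar>)"
    using abs_ge_self[of "(unit_clamp ?b - unit_clamp a) * (- (t * v))"] assms
    by (simp only: abs_mult abs_minus abs_of_nonneg)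
  moreover have "\<bar>unit_clamp ?b - unit_clamp a\<bar> * (t * \<bar>v\<bar>) \<le> (t * \<bar>v\<bar>) * (t * \<bar>v\<bar>)"
    using unit_clamp_diff_le[of ?b a] assms by (intro mult_right_mono) (auto simp: abs_mult)
  moreover have "\<bar>unit_clamp ?b - unit_clamp a\<bar> * (t * \<bar>v\<bar>) \<le> 2 * (t * \<bar>v\<bar>)"
    using abs_unit_clamp_le[of ?b] abs_unit_clamp_le[of a] assms by (intro mult_right_mono) auto
  ultimately have "huber ?b \<le> huber a - t * (unit_clamp a * v) + min ((t * \<bar>v\<bar>) * (t * \<bar>v\<bar>)) (2 * (t * \<bar>v\<bar>))"
    by linarith
  also have "min ((t * \<bar>v\<bar>) * (t * \<bar>v\<bar>)) (2 * (t * \<bar>v\<bar>)) = t * min (t * v\<^sup>2) (2 * \<bar>v\<bar>)"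
    using assms by (simp add: min_mult_distrib_left power2_eq_square mult_ac)
  finally show ?thesis .
qed

text \<open>Convexity together with \<open>huber 0 = 0\<close>: the tangent inequalities at t*x,
  towards x and towards 0, are averaged with weights t and 1 - t.\<close>

lemma huber_scale_le:
  assumes "0 \<le> t" "t \<le> 1"
  shows "huber (t * x) \<le> t * huber x"
proof -
  have 1: "huber (t*x) + unit_clamp (t*x) * (x - t*x) \<le> huber x"
    by (rule huber_ge_tangent_line)
  have 2: "huber (t*x) + unit_clamp (t*x) * (0 - t*x) \<le> 0"
    using huber_ge_tangent_line[of "t*x" 0] by (simp add: huber_def[of 0] unit_clamp_def[of 0])
  have "t * (huber (t*x) + unit_clamp (t*x) * (x - t*x)) + (1 - t) * (huber (t*x) + unit_clamp (t*x) * (0 - t*x))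
     \<le> t * huber x + (1 - t) * 0"
    using assms 1 2 by (intro add_mono mult_left_mono) auto
  then show ?thesis by (simp add: algebra_simps)
qed

text \<open>The tangent at s or -s has slope s or -s and touches at height s^2/2, because s \<le> 1.
  This turns a lower bound on the L1 distance into one on the Huber objective.\<close>

lemma abs_le_huber:
  assumes "0 < s" "s \<le> 1"
  shows "\<bar>x\<bar> \<le> huber x / s + s / 2"
proof -
  have "s * \<bar>x\<bar> - s\<^sup>2 / 2 \<le> huber x"
  proof (cases "0 \<le> x")
    case True
    then show ?thesis
      using huber_ge_tangent_line[of s x] assms
      by (simp add: huber_def[of s] unit_clamp_def[of s] power2_eq_square algebra_simps)
  next
    case False
    then show ?thesis
      using huber_ge_tangent_line[of "-s" x] assms
      by (simp add: huber_def[of "-s"] unit_clamp_def[of "-s"] power2_eq_square algebra_simps)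
  qed
  then show ?thesis
    using assms by (simp add: field_simps power2_eq_square)
qed

lemma integrable_huber:
  assumes "integrable M f"
  shows "integrable M (\<lambda>x. huber (f x))"
proof -
  have [measurable]: "f \<in> borel_measurable M" using assms by simp
  show ?thesis
    by (rule Bochner_Integration.integrable_bound[OF integrable_abs[OF assms]])
       (auto simp: huber_nonneg huber_le_abs)
qed

lemma integrable_mult_bounded:
  fixes f Z :: "'a \<Rightarrow> real"
  assumes "integrable M f" "Z \<in> borel_measurable M" "\<And>x. \<bar>Z x\<bar> \<le> B"
  shows "integrable M (\<lambda>x. Z x * f x)"
proof -
  have [measurable]: "f \<in> borel_measurable M" "Z \<in> borel_measurable M" using assms by simp_all
  show ?thesis
  proof (rule Bochner_Integration.integrable_bound)
    show "integrable M (\<lambda>x. B * f x)" using assms by simp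
    show "AE x in M. norm (Z x * f x) \<le> norm (B * f x)"
      using order_trans[OF assms(3) abs_ge_self] by (auto simp: abs_mult intro!: mult_right_mono)
  qed simp
qed

section \<open>Separation of a point from a convex cone in L1\<close>

text \<open>First-order optimality without a minimiser: the optimality conditions hold approximately
  along a minimising sequence and pass to the limit of the derivatives. The bound \<delta> makes the
  infimum positive, which yields the strict inequality for Y.\<close>

lemma (in prob_space) L1_cone_separation:
  fixes C :: "('a \<Rightarrow> real) set" and Y :: "'a \<Rightarrow> real"
  assumes int: "\<And>W. W \<in> C \<Longrightarrow> integrable M W"
    and ne: "C \<noteq> {}"
    and add: "\<And>V W. V \<in> C \<Longrightarrow> W \<in> C \<Longrightarrow> (\<lambda>x. V x + W x) \<in> C"
    and scale: "\<And>c W. 0 \<le> c \<Longrightarrow> W \<in> C \<Longrightarrow> (\<lambda>x. c * W x) \<in> C"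
    and Y: "integrable M Y"
    and \<delta>: "0 < \<delta>" "\<And>W. W \<in> C \<Longrightarrow> \<delta> \<le> (\<integral>x. \<bar>Y x - W x\<bar> \<partial>M)"
  shows "\<exists>Z\<in>borel_measurable M. (\<forall>x. \<bar>Z x\<bar> \<le> 1) \<and>
    (\<forall>V\<in>C. (\<integral>x. Z x * V x \<partial>M) \<le> 0) \<and> 0 < (\<integral>x. Z x * Y x \<partial>M)"
proof -
  define F where "F W = (\<integral>x. huber (Y x - W x) \<partial>M)" for W
  define I where "I = Inf (F ` C)"
  have inth: "integrable M (\<lambda>x. huber (Y x - W x))" if "integrable M W" for W
    using that Y by (intro integrable_huber) auto
  have bdd: "bdd_below (F ` C)"
    by (intro bdd_belowI[of _ 0]) (auto simp: F_def huber_nonneg)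
  have I_le: "I \<le> F W" if "W \<in> C" for W
    unfolding I_def using bdd that by (intro cInf_lower) auto
  have I_pos: "0 < I"
  proof -
    \<comment> \<open>With s \<le> \<delta>, the bound \<delta> \<le> F W / s + s/2 leaves at least
      \<delta>/2 for F W / s; s \<le> 1 is required by \<open>abs_le_huber\<close>.\<close>
    define s where "s = min 1 \<delta>"
    have s: "0 < s" "s \<le> 1" "s \<le> \<delta>" using \<delta> by (auto simp: s_def)
    have "s * (\<delta> / 2) \<le> F W" if W: "W \<in> C" for W
    proof -
      have "\<delta> \<le> (\<integral>x. \<bar>Y x - W x\<bar> \<partial>M)" using \<delta> W by auto
      also have "\<dots> \<le> (\<integral>x. huber (Y x - W x) / s + s / 2 \<partial>M)"
        using s Y int[OF W] inth[OF int[OF W]] abs_le_huber by (intro integral_mono) auto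
      also have "\<dots> = F W / s + s / 2"
        using inth[OF int[OF W]] by (simp add: F_def prob_space)
      finally have "\<delta> / 2 \<le> F W / s" using s by linarith
      then show ?thesis using s by (simp add: field_simps)
    qed
    then have "s * (\<delta> / 2) \<le> I"
      unfolding I_def using ne by (intro cInf_greatest) auto
    moreover have "0 < s * (\<delta> / 2)" using s \<delta> by simp
    ultimately show ?thesis by linarith
  qed
  have "\<exists>W\<in>C. F W < I + 1 / real (Suc n)" for n
    using cInf_lessD[of "F ` C" "I + 1 / real (Suc n)"] ne unfolding I_def by auto
  then obtain W where W: "\<And>n. W n \<in> C" and FW: "\<And>n. F (W n) < I + 1 / real (Suc n)"
    by metis
  define \<zeta> where "\<zeta> n x = unit_clamp (Y x - W n x)" for n x
  note [simp] = int[OF W]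
  have [measurable]: "Y \<in> borel_measurable M" "\<And>n. W n \<in> borel_measurable M"
    using Y by (auto intro: borel_measurable_integrable int[OF W])
  have [measurable]: "\<zeta> n \<in> borel_measurable M" for n
    unfolding \<zeta>_def by measurable
  have \<zeta>_bd: "\<bar>\<zeta> n x\<bar> \<le> 1" for n x
    by (simp add: \<zeta>_def abs_unit_clamp_le)
  have \<zeta>_int: "integrable M (\<zeta> n)" for n
    by (rule integrable_const_bound[where B = 1]) (auto simp: \<zeta>_bd)
  \<comment> \<open>The midpoint of \<open>W n\<close> and \<open>W m\<close> lies in the cone, so
    its objective is at least I, while both endpoints exceed I by less than 1/(n+1) and
    1/(m+1).\<close>
  have sq: "(\<integral>x. (\<zeta> n x - \<zeta> m x)\<^sup>2 \<partial>M) \<le> 4 * (1 / real (Suc n) + 1 / real (Suc m))"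
    and sq_int: "integrable M (\<lambda>x. (\<zeta> n x - \<zeta> m x)\<^sup>2)" for n m
  proof -
    let ?V = "\<lambda>x. (1/2) * (W n x + W m x)"
    have V: "?V \<in> C"
      using scale[OF _ add[OF W W], of "1/2" n m] by simp
    have "norm ((\<zeta> n x - \<zeta> m x)\<^sup>2) \<le> 4" for x
      using \<zeta>_bd[of n x] \<zeta>_bd[of m x] power_mono[of "\<bar>\<zeta> n x - \<zeta> m x\<bar>" 2 2] by simp
    then show i: "integrable M (\<lambda>x. (\<zeta> n x - \<zeta> m x)\<^sup>2)"
      by (intro integrable_const_bound[where B = 4]) auto
    have "(\<integral>x. (\<zeta> n x - \<zeta> m x)\<^sup>2 \<partial>M)
        \<le> (\<integral>x. 4 * (huber (Y x - W n x) + huber (Y x - W m x) - 2 * huber (Y x - ?V x)) \<partial>M)"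
    proof (rule integral_mono[OF i])
      show "integrable M (\<lambda>x. 4 * (huber (Y x - W n x) + huber (Y x - W m x) - 2 * huber (Y x - ?V x)))"
        using inth[OF int[OF W]] inth[OF int[OF V]] by (intro integrable_mult_right Bochner_Integration.integrable_diff Bochner_Integration.integrable_add) auto
      fix x
      have "Y x - ?V x = (Y x - W n x + (Y x - W m x)) / 2"
        by (simp add: field_simps)
      with huber_midpoint[of "Y x - W n x" "Y x - W m x"]
      show "(\<zeta> n x - \<zeta> m x)\<^sup>2
          \<le> 4 * (huber (Y x - W n x) + huber (Y x - W m x) - 2 * huber (Y x - ?V x))"
        by (simp only: \<zeta>_def)
    qed
    also have "\<dots> = 4 * (F (W n) + F (W m) - 2 * F ?V)"
      using inth[OF int[OF W]] inth[OF int[OF V]] unfolding F_def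
      by simp
    also have "\<dots> \<le> 4 * (1 / real (Suc n) + 1 / real (Suc m))"
      using FW[of n] FW[of m] I_le[OF V] by simp
    finally show "(\<integral>x. (\<zeta> n x - \<zeta> m x)\<^sup>2 \<partial>M) \<le> 4 * (1 / real (Suc n) + 1 / real (Suc m))" .
  qed
  obtain r :: "nat \<Rightarrow> nat" where r: "strict_mono r" "AE x in M. Cauchy (\<lambda>i. \<zeta> (r i) x)"
  proof (rule cauchy_L1_AE_cauchy_subseq[of M \<zeta>])
    show "integrable M (\<zeta> n)" for n by (rule \<zeta>_int)
    fix e :: real assume e: "0 < e"
    \<comment> \<open>Beyond N, the squared distance is below 4 * 2 * e^2/16 = e^2/2.\<close>
    obtain N where N: "1 / real (Suc N) < e\<^sup>2 / 16"
      using nat_approx_posE[of "e\<^sup>2/16"] e by auto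
    show "\<exists>N. \<forall>i\<ge>N. \<forall>j\<ge>N. LINT x|M. norm (\<zeta> i x - \<zeta> j x) < e"
    proof (intro exI allI impI)
      fix i j assume ij: "N \<le> i" "N \<le> j"
      have "1 / real (Suc i) \<le> 1 / real (Suc N)" "1 / real (Suc j) \<le> 1 / real (Suc N)"
        using ij by (auto intro!: divide_left_mono)
      then have s: "(\<integral>x. (\<zeta> i x - \<zeta> j x)\<^sup>2 \<partial>M) < e\<^sup>2 / 2"
        using sq[of i j] N by argo
      \<comment> \<open>Weighted AM-GM passes from the L2 estimate to an L1 estimate; the total
        becomes e/2 + e/4.\<close>
      have am: "\<bar>d\<bar> \<le> e / 2 + d\<^sup>2 / (2 * e)" for d :: real
        using zero_le_power2[of "\<bar>d\<bar> - e"] e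
        by (simp add: field_simps power2_eq_square)
      have "(\<integral>x. norm (\<zeta> i x - \<zeta> j x) \<partial>M) \<le> (\<integral>x. e / 2 + (\<zeta> i x - \<zeta> j x)\<^sup>2 / (2 * e) \<partial>M)"
        using \<zeta>_int sq_int am by (intro integral_mono) auto
      also have "\<dots> = e / 2 + (\<integral>x. (\<zeta> i x - \<zeta> j x)\<^sup>2 \<partial>M) / (2 * e)"
        using sq_int[of i j] by (simp add: prob_space)
      also have "\<dots> < e / 2 + (e\<^sup>2 / 2) / (2 * e)"
        using s e by (intro add_strict_left_mono divide_strict_right_mono) auto
      also have "\<dots> \<le> e" using e by (simp add: field_simps power2_eq_square)
      finally show "(\<integral>x. norm (\<zeta> i x - \<zeta> j x) \<partial>M) < e" .
    qed
  qed
  \<comment> \<open>Clamping bounds Z at every point, including those where the sequence diverges.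
    Where it converges, the limit already lies in [-1,1] and is unchanged.\<close>
  define Z where "Z x = unit_clamp (lim (\<lambda>i. \<zeta> (r i) x))" for x
  have [measurable]: "Z \<in> borel_measurable M"
    unfolding Z_def by measurable
  have Z_bd: "\<bar>Z x\<bar> \<le> 1" for x
    by (simp add: Z_def abs_unit_clamp_le)
  have Z_lim: "AE x in M. (\<lambda>i. \<zeta> (r i) x) \<longlonglongrightarrow> Z x"
    using r(2)
  proof eventually_elim
    fix x assume "Cauchy (\<lambda>i. \<zeta> (r i) x)"
    then have l: "(\<lambda>i. \<zeta> (r i) x) \<longlonglongrightarrow> lim (\<lambda>i. \<zeta> (r i) x)"
      by (simp add: Cauchy_convergent convergent_LIMSEQ_iff[symmetric])
    moreover have "\<bar>lim (\<lambda>i. \<zeta> (r i) x)\<bar> \<le> 1"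
      using tendsto_rabs[OF l] \<zeta>_bd by (intro LIMSEQ_le_const2) auto
    ultimately show "(\<lambda>i. \<zeta> (r i) x) \<longlonglongrightarrow> Z x"
      by (simp add: Z_def unit_clamp_def)
  qed
  \<comment> \<open>If moving from any \<open>W n\<close> by t*V leaves the objective at or above I
    + t*c, then the limiting slope in direction V, which is minus the integral of Z*V, is at least
    c.\<close>
  have variation: "(\<integral>x. Z x * V x \<partial>M) \<le> - c"
    if V: "integrable M V"
      and low: "\<And>t n. 0 < t \<Longrightarrow> t \<le> 1 \<Longrightarrow> I + t * c \<le> (\<integral>x. huber (Y x - W n x - t * V x) \<partial>M)"
    for V c
  proof -
    have [measurable]: "V \<in> borel_measurable M" using V by simp
    \<comment> \<open>The error term of \<open>huber_diff_le\<close>: it tends to 0 with t and is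
      dominated by 2|V|, although V^2 may fail to be integrable.\<close>
    define \<rho> where "\<rho> t x = min (t * (V x)\<^sup>2) (2 * \<bar>V x\<bar>)" for t x
    have [measurable]: "\<rho> t \<in> borel_measurable M" for t
      unfolding \<rho>_def by measurable
    have \<rho>_bd: "\<bar>\<rho> t x\<bar> \<le> 2 * \<bar>V x\<bar>" if "0 < t" for t x
      using that by (auto simp: \<rho>_def)
    have \<rho>_int: "integrable M (\<rho> t)" if "0 < t" for t
      by (rule Bochner_Integration.integrable_bound[of M "\<lambda>x. 2 * \<bar>V x\<bar>"]) (use V \<rho>_bd[OF that] in auto)
    have \<zeta>V_int: "integrable M (\<lambda>x. \<zeta> n x * V x)" for n
      using V \<zeta>_bd by (intro integrable_mult_bounded[where B = 1]) auto
    have lim1: "(\<lambda>i. \<integral>x. \<zeta> (r i) x * V x \<partial>M) \<longlonglongrightarrow> (\<integral>x. Z x * V x \<partial>M)"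
    proof (rule integral_dominated_convergence[where w = "\<lambda>x. \<bar>V x\<bar>"])
      show "AE x in M. (\<lambda>i. \<zeta> (r i) x * V x) \<longlonglongrightarrow> Z x * V x"
        using Z_lim by eventually_elim (intro tendsto_intros)
      show "AE x in M. norm (\<zeta> (r i) x * V x) \<le> \<bar>V x\<bar>" for i
        using \<zeta>_bd by (auto simp: abs_mult intro!: mult_left_le_one_le)
    qed (use V in auto)
    \<comment> \<open>At fixed t, the suboptimality 1/(n+1) divided by t vanishes as n grows along
      the subsequence; only afterwards is t sent to 0.\<close>
    have step: "(\<integral>x. Z x * V x \<partial>M) \<le> - c + (\<integral>x. \<rho> t x \<partial>M)" if t: "0 < t" "t \<le> 1" for t
    proof -
      have bound: "(\<integral>x. \<zeta> n x * V x \<partial>M) \<le> 1 / real (Suc n) / t - c + (\<integral>x. \<rho> t x \<partial>M)" for n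
      proof -
        have "I + t * c \<le> (\<integral>x. huber (Y x - W n x - t * V x) \<partial>M)" using low t by auto
        also have "\<dots> \<le> (\<integral>x. huber (Y x - W n x) - t * (\<zeta> n x * V x) + t * \<rho> t x \<partial>M)"
        proof (rule integral_mono)
          show "integrable M (\<lambda>x. huber (Y x - W n x - t * V x))"
            using V Y by (intro integrable_huber) auto
          show "integrable M (\<lambda>x. huber (Y x - W n x) - t * (\<zeta> n x * V x) + t * \<rho> t x)"
            using \<zeta>V_int \<rho>_int t inth[OF int[OF W]] by (intro Bochner_Integration.integrable_add Bochner_Integration.integrable_diff integrable_mult_right) auto
          show "huber (Y x - W n x - t * V x) \<le> huber (Y x - W n x) - t * (\<zeta> n x * V x) + t * \<rho> t x" for x
            unfolding \<rho>_def \<zeta>_def using t by (intro huber_diff_le) auto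
        qed
        also have "\<dots> = F (W n) - t * (\<integral>x. \<zeta> n x * V x \<partial>M) + t * (\<integral>x. \<rho> t x \<partial>M)"
          using \<zeta>V_int \<rho>_int t inth[OF int[OF W]] by (simp add: F_def)
        finally have "t * (\<integral>x. \<zeta> n x * V x \<partial>M) \<le> 1 / real (Suc n) - t * c + t * (\<integral>x. \<rho> t x \<partial>M)"
          using FW[of n] by linarith
        also have "\<dots> = t * (1 / real (Suc n) / t - c + (\<integral>x. \<rho> t x \<partial>M))"
          using t by (simp add: distrib_left right_diff_distrib)
        finally show ?thesis using t mult_le_cancel_left_pos by blast
      qed
      have "(\<lambda>i. 1 / real (Suc (r i))) \<longlonglongrightarrow> 0"
        using LIMSEQ_subseq_LIMSEQ[OF LIMSEQ_Suc[OF lim_1_over_n] r(1)] by (simp add: o_def)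
      then have "(\<lambda>i. 1 / real (Suc (r i)) / t - c + (\<integral>x. \<rho> t x \<partial>M)) \<longlonglongrightarrow> 0 / t - c + (\<integral>x. \<rho> t x \<partial>M)"
        using t by (intro tendsto_add tendsto_diff tendsto_divide tendsto_const) auto
      from LIMSEQ_le[OF lim1 this] bound show ?thesis by auto
    qed
    have "(\<lambda>k. \<integral>x. \<rho> (1 / real (Suc k)) x \<partial>M) \<longlonglongrightarrow> (\<integral>x. 0 \<partial>M)"
    proof (rule integral_dominated_convergence[where w = "\<lambda>x. 2 * \<bar>V x\<bar>"])
      have "(\<lambda>k. \<rho> (1 / real (Suc k)) x) \<longlonglongrightarrow> min (0 * (V x)\<^sup>2) (2 * \<bar>V x\<bar>)" for x
        unfolding \<rho>_def by (intro tendsto_min tendsto_mult tendsto_const LIMSEQ_Suc[OF lim_1_over_n])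
      then show "AE x in M. (\<lambda>k. \<rho> (1 / real (Suc k)) x) \<longlonglongrightarrow> 0"
        by simp
    qed (use V \<rho>_bd in auto)
    then have "(\<lambda>k. - c + (\<integral>x. \<rho> (1 / real (Suc k)) x \<partial>M)) \<longlonglongrightarrow> - c + 0"
      by (intro tendsto_add tendsto_const) auto
    then show ?thesis
      using step by (intro LIMSEQ_le_const) auto
  qed
  show ?thesis
  proof (intro bexI conjI allI ballI)
    show "Z \<in> borel_measurable M" by measurable
    show "\<bar>Z x\<bar> \<le> 1" for x by (rule Z_bd)
    show "(\<integral>x. Z x * V x \<partial>M) \<le> 0" if V: "V \<in> C" for V
    proof -
      \<comment> \<open>For V in the cone, \<open>W n\<close> + t*V stays in the cone, so c = 0 is
        admissible.\<close>
      have "I + t * 0 \<le> (\<integral>x. huber (Y x - W n x - t * V x) \<partial>M)" if "0 < t" for t n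
        using I_le[OF add[OF W[of n] scale[OF _ V]], of t] that by (simp add: F_def diff_diff_eq)
      from variation[of V 0] this int[OF V] show ?thesis by auto
    qed
    \<comment> \<open>In direction -Y the residual becomes (1+t) * (Y - W/(1+t)), and W/(1+t) is
      again in the cone. \<open>huber_scale_le\<close> with factor 1/(1+t) bounds the objective
      below by (1+t)*I, so c = I.\<close>
    have "I + t * I \<le> (\<integral>x. huber (Y x - W n x - t * (- Y x)) \<partial>M)" if t: "0 < t" for t n
    proof -
      let ?s = "1 / (1 + t)"
      let ?U = "\<lambda>x. ?s * W n x"
      have U: "?U \<in> C" using t by (intro scale W) auto
      have "I \<le> F ?U" by (rule I_le[OF U])
      also have "\<dots> \<le> (\<integral>x. ?s * huber (Y x - W n x - t * (- Y x)) \<partial>M)"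
        unfolding F_def
      proof (rule integral_mono)
        show "integrable M (\<lambda>x. huber (Y x - ?U x))" by (rule inth[OF int[OF U]])
        show "integrable M (\<lambda>x. ?s * huber (Y x - W n x - t * (- Y x)))"
          using Y by (intro integrable_mult_right integrable_huber) auto
        fix x
        have "Y x - ?U x = ?s * (Y x - W n x - t * (- Y x))"
          using t by (simp add: field_simps)
        then show "huber (Y x - ?U x) \<le> ?s * huber (Y x - W n x - t * (- Y x))"
          using huber_scale_le[of ?s "Y x - W n x - t * (- Y x)"] t by simp
      qed
      finally show ?thesis using t by (simp add: field_simps)
    qed
    from variation[of "\<lambda>x. - Y x" I] this Y have "(\<integral>x. Z x * (- Y x) \<partial>M) \<le> - I" by auto
    then show "0 < (\<integral>x. Z x * Y x \<partial>M)" using I_pos by simp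
  qed
qed

section \<open>Changes of measure that stay in \<open>M_Phi\<close>\<close>

lemma Phi_plus_ereal: "\<Phi> y = ereal a \<Longrightarrow> Phi_plus \<Phi> y = ereal (max a 0)"
  by (simp add: Phi_plus_def max_def zero_ereal_def)

text \<open>A finite convex function is continuous on the open half-line. The point 0 is split off,
  since \<Phi> may jump or be infinite there.\<close>

lemma Phi_plus_measurable:
  assumes \<Phi>: "convex_Phi \<Phi>" and f: "f \<in> borel_measurable M"
  shows "(\<lambda>x. e2ennreal (Phi_plus \<Phi> (enn2real (f x)))) \<in> borel_measurable M"
proof -
  define \<phi> where "\<phi> y = real_of_ereal (\<Phi> y)" for y
  have \<phi>: "\<Phi> y = ereal (\<phi> y)" if "0 < y" for y
    using \<Phi> that by (cases "\<Phi> y") (auto simp: convex_Phi_def \<phi>_def)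
  have "convex_on {0<..} \<phi>"
  proof
    fix t x y :: real
    assume t: "0 < t" "t < 1" and xy: "x \<in> {0<..}" "y \<in> {0<..}"
    then have pos: "0 < (1 - t) * x + t * y" by (intro add_pos_pos) auto
    have "\<Phi> ((1 - t) * x + t * y) \<le> ereal (1 - t) * \<Phi> x + ereal t * \<Phi> y"
      using \<Phi> t xy unfolding convex_Phi_def by auto
    then show "\<phi> ((1 - t) *\<^sub>R x + t *\<^sub>R y) \<le> (1 - t) * \<phi> x + t * \<phi> y"
      using xy pos by (simp add: \<phi>)
  qed auto
  then have "continuous_on {0<..} \<phi>"
    by (intro convex_on_continuous) auto
  then have "(\<lambda>y. indicator {0<..} y *\<^sub>R \<phi> y) \<in> borel_measurable borel"
    by (intro borel_measurable_continuous_on_indicator) auto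
  then have [measurable]: "(\<lambda>x. indicator {0<..} (enn2real (f x)) *\<^sub>R \<phi> (enn2real (f x))) \<in> borel_measurable M"
    using f by (rule_tac measurable_compose[rotated]) auto
  \<comment> \<open>\<open>ennreal\<close> sends negative reals to 0 and so takes the positive part
    by itself.\<close>
  have "e2ennreal (Phi_plus \<Phi> (enn2real (f x))) =
      (if enn2real (f x) = 0 then e2ennreal (Phi_plus \<Phi> 0)
       else ennreal (indicator {0<..} (enn2real (f x)) *\<^sub>R \<phi> (enn2real (f x))))" for x
  proof (cases "enn2real (f x) = 0")
    case False
    then have pos: "0 < enn2real (f x)"
      using enn2real_nonneg[of "f x"] by linarith
    have "ennreal (max a 0) = ennreal a" for a
      by (simp add: max_def ennreal_neg)
    then show ?thesis
      using pos by (simp add: Phi_plus_ereal[OF \<phi>] del: ereal_max)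
  qed simp
  with f show ?thesis by simp
qed

text \<open>The new density with respect to P is g times dQ/dP. Since g takes values in a compact
  subinterval of the open half-line, the growth condition with l = g x and y = dQ/dP bounds the new
  integrand by integrable terms.\<close>

lemma density_in_M_Phi:
  assumes P: "prob_space P" and \<Phi>: "convex_Phi \<Phi>" "growth_condition \<Phi>"
    and Q: "Q \<in> M_Phi P K \<Phi>"
    and g: "g \<in> borel_measurable P" "0 < l0" "\<And>x. l0 \<le> g x" "\<And>x. g x \<le> l1"
    and g1: "(\<integral>x. g x \<partial>Q) = 1"
    and gK: "\<And>X. X \<in> K \<Longrightarrow> (\<integral>x. g x * X x \<partial>Q) \<le> 0"
  shows "density Q (\<lambda>x. ennreal (g x)) \<in> M_Phi P K \<Phi>"
proof -
  interpret P: prob_space P by fact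
  have Q': "prob_space Q" "sets Q = sets P" "absolutely_continuous P Q" "K \<subseteq> L1 P Q"
    and fin: "(\<integral>\<^sup>+ \<omega>. e2ennreal (Phi_plus \<Phi> (enn2real (RN_deriv P Q \<omega>))) \<partial>P) < \<infinity>"
    using Q by (auto simp: M_Phi_def M1_def)
  interpret Q: prob_space Q by fact
  have meas: "borel_measurable Q = borel_measurable P"
    using Q'(2) by (intro measurable_cong_sets) auto
  note [measurable] = g(1)
  have gQ [measurable]: "g \<in> borel_measurable Q" unfolding meas by (rule g(1))
  have g_nonneg: "0 \<le> g x" for x using g(2) g(3)[of x] by linarith
  have g_bd: "\<bar>g x\<bar> \<le> l1" for x using g_nonneg[of x] g(4)[of x] by simp
  let ?R = "density Q (\<lambda>x. ennreal (g x))"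
  have RN: "density P (RN_deriv P Q) = Q"
    using Q' by (intro P.density_RN_deriv) auto
  have R_eq: "?R = density P (\<lambda>x. RN_deriv P Q x * ennreal (g x))"
    by (subst RN[symmetric], subst density_density_eq) auto
  have "prob_space ?R"
  proof
    have "emeasure ?R (space ?R) = (\<integral>\<^sup>+x. ennreal (g x) \<partial>Q)"
      by (subst emeasure_density) (auto intro!: nn_integral_cong)
    also have "\<dots> = ennreal (\<integral>x. g x \<partial>Q)"
      using g_nonneg g_bd by (intro nn_integral_eq_integral Q.integrable_const_bound[where B = l1]) auto
    finally show "emeasure ?R (space ?R) = 1" using g1 by simp
  qed
  moreover have "absolutely_continuous P ?R"
    unfolding R_eq by (intro absolutely_continuousI_density) auto
  moreover have "X \<in> L1 P ?R \<and> (\<integral>x. X x \<partial>?R) \<le> 0" if X: "X \<in> K" for X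
  proof -
    have X': "X \<in> borel_measurable P" "integrable Q X" using X Q' by (auto simp: L1_def)
    have [measurable]: "X \<in> borel_measurable Q" using X'(2) by simp
    have "integrable ?R X"
      using X' g_nonneg g_bd by (subst integrable_density) (auto intro!: integrable_mult_bounded[where B = l1])
    moreover have "(\<integral>x. X x \<partial>?R) = (\<integral>x. g x * X x \<partial>Q)"
      using g_nonneg by (subst integral_density) auto
    ultimately show ?thesis
      using X' gK[OF X] by (simp add: L1_def)
  qed
  ultimately have M1: "?R \<in> M1 P K"
    using Q'(2) by (auto simp: M1_def)
  have "l0 \<le> l1" using g(3)[of undefined] g(4)[of undefined] by linarith
  then obtain \<alpha> \<beta> where \<alpha>: "0 < \<alpha>" and \<beta>: "0 < \<beta>" and grow: "\<And>y l. 0 < y \<Longrightarrow> l0 \<le> l \<Longrightarrow> l \<le> l1 \<Longrightarrow>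
      Phi_plus \<Phi> (l * y) \<le> ereal \<alpha> * Phi_plus \<Phi> y + ereal (\<beta> * (y + 1))"
    using \<Phi>(2)[unfolded growth_condition_def, rule_format, of l0 l1] g(2) by auto
  let ?q = "\<lambda>x. enn2real (RN_deriv P Q x)"
  let ?h = "\<lambda>x. e2ennreal (Phi_plus \<Phi> (?q x))"
  have h [measurable]: "?h \<in> borel_measurable P"
    by (intro Phi_plus_measurable \<Phi>) auto
  \<comment> \<open>The growth condition says nothing at y = 0, where \<open>Phi_plus\<close> may be
    positive or infinite. A coefficient of at least 1 makes the bound trivial there.\<close>
  have growth: "e2ennreal (Phi_plus \<Phi> (l * y)) \<le> ennreal (max 1 \<alpha>) * e2ennreal (Phi_plus \<Phi> y) + ennreal (\<beta> * (y + 1))"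
    if "0 \<le> y" "l0 \<le> l" "l \<le> l1" for l y
  proof (cases "y = 0")
    case True
    have "1 * e2ennreal (Phi_plus \<Phi> 0) \<le> ennreal (max 1 \<alpha>) * e2ennreal (Phi_plus \<Phi> 0)"
      by (intro mult_right_mono) (auto simp flip: ennreal_1 intro!: ennreal_leI)
    also have "\<dots> \<le> ennreal (max 1 \<alpha>) * e2ennreal (Phi_plus \<Phi> 0) + ennreal (\<beta> * (0 + 1))"
      by simp
    finally show ?thesis using True by simp
  next
    case False
    with that have y: "0 < y" by simp
    then have "\<Phi> y \<noteq> \<infinity>" "\<Phi> y \<noteq> - \<infinity>"
      using \<Phi>(1) by (auto simp: convex_Phi_def)
    then obtain a where "\<Phi> y = ereal a" by (cases "\<Phi> y") auto
    then have "Phi_plus \<Phi> y = ereal (max a 0)" by (rule Phi_plus_ereal)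
    then obtain p where p: "Phi_plus \<Phi> y = ereal p" "0 \<le> p"
      using max.cobounded2 by blast
    have "e2ennreal (Phi_plus \<Phi> (l * y)) \<le> e2ennreal (ereal (\<alpha> * p + \<beta> * (y + 1)))"
      using grow[OF y that(2,3)] p by (intro e2ennreal_mono) simp
    also have "\<dots> = ennreal \<alpha> * ennreal p + ennreal (\<beta> * (y + 1))"
      using \<alpha> \<beta> p y by (simp add: ennreal_mult ennreal_plus)
    also have "\<dots> \<le> ennreal (max 1 \<alpha>) * ennreal p + ennreal (\<beta> * (y + 1))"
      by (intro add_right_mono mult_right_mono ennreal_leI) auto
    finally show ?thesis using p by simp
  qed
  have "AE x in P. RN_deriv P ?R x = RN_deriv P Q x * ennreal (g x)"
    by (rule AE_symmetric[OF P.RN_deriv_unique[OF _ R_eq[symmetric]]]) auto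
  then have "(\<integral>\<^sup>+ x. e2ennreal (Phi_plus \<Phi> (enn2real (RN_deriv P ?R x))) \<partial>P)
      = (\<integral>\<^sup>+ x. e2ennreal (Phi_plus \<Phi> (g x * ?q x)) \<partial>P)"
    using g_nonneg by (intro nn_integral_cong_AE) (auto simp: enn2real_mult mult.commute)
  also have "\<dots> \<le> (\<integral>\<^sup>+ x. ennreal (max 1 \<alpha>) * ?h x + ennreal (\<beta> * (?q x + 1)) \<partial>P)"
    using g by (intro nn_integral_mono growth) auto
  also have "\<dots> = ennreal (max 1 \<alpha>) * (\<integral>\<^sup>+ x. ?h x \<partial>P) + ennreal \<beta> * ((\<integral>\<^sup>+ x. ennreal (?q x) \<partial>P) + 1)"
    using \<beta> by (simp add: nn_integral_add nn_integral_cmult ennreal_mult ennreal_plus P.emeasure_space_1)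
  also have "\<dots> < \<infinity>"
  proof -
    \<comment> \<open>\<open>enn2real\<close> sends \<infinity> to 0, so the real-valued density is
      at most the original one, whose integral is 1.\<close>
    have "(\<integral>\<^sup>+ x. ennreal (?q x) \<partial>P) \<le> (\<integral>\<^sup>+ x. RN_deriv P Q x \<partial>P)"
      by (intro nn_integral_mono) (simp add: ennreal_enn2real_if)
    also have "\<dots> = emeasure (density P (RN_deriv P Q)) (space P)"
      by (subst emeasure_density) (auto intro!: nn_integral_cong)
    also have "\<dots> = 1"
      unfolding RN using Q.emeasure_space_1 Q'(2) sets_eq_imp_space_eq by metis
    finally have "(\<integral>\<^sup>+ x. ennreal (?q x) \<partial>P) < \<infinity>"
      by (rule le_less_trans) simp
    with fin show ?thesis
      by (simp add: ennreal_mult_less_top ennreal_add_less_top)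
  qed
  finally show ?thesis using M1 by (simp add: M_Phi_def)
qed

section \<open>The cone of dominated payoffs and its L1(Q)-closure\<close>

lemma wedge_L0_scale:
  assumes "wedge_L0 P K" "X \<in> K" "0 \<le> c"
  shows "(\<lambda>\<omega>. c * X \<omega>) \<in> K"
  using assms by (auto simp: wedge_L0_def)

lemma wedge_L0_add:
  assumes "wedge_L0 P K" "X \<in> K" "Y \<in> K"
  shows "(\<lambda>\<omega>. X \<omega> + Y \<omega>) \<in> K"
proof -
  have "(\<lambda>\<omega>. (1 - 1/2) * X \<omega> + 1/2 * Y \<omega>) \<in> K"
    using assms unfolding wedge_L0_def by (elim conjE, elim ballE[of K _ X] ballE[of K _ Y] ballE[of _ _ "1/2"]) auto
  then have "(\<lambda>\<omega>. 2 * ((1 - 1/2) * X \<omega> + 1/2 * Y \<omega>)) \<in> K"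
    by (rule wedge_L0_scale[OF assms(1)]) simp
  then show ?thesis by (simp add: distrib_left)
qed

lemma K_minus_L1_plus_integral_nonpos:
  assumes Q: "Q \<in> M1 P K" and W: "W \<in> K_minus_L1_plus P K Q"
  shows "W \<in> borel_measurable P" "integrable Q W" "(\<integral>\<omega>. W \<omega> \<partial>Q) \<le> 0"
proof -
  obtain Y Z where W_eq: "W = (\<lambda>\<omega>. Y \<omega> - Z \<omega>)" and Y: "Y \<in> K" and Z: "Z \<in> L1_plus P Q"
    using W by (auto simp: K_minus_L1_plus_def)
  have Y': "Y \<in> borel_measurable P" "integrable Q Y" "(\<integral>\<omega>. Y \<omega> \<partial>Q) \<le> 0"
    using Q Y by (auto simp: M1_def L1_def)
  have Z': "Z \<in> borel_measurable P" "integrable Q Z" "AE \<omega> in P. 0 \<le> Z \<omega>"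
    using Z by (auto simp: L1_plus_def L1_def)
  have "AE \<omega> in Q. 0 \<le> Z \<omega>"
    using Q Z'(3) by (auto simp: M1_def intro: absolutely_continuous_AE)
  then have "0 \<le> (\<integral>\<omega>. Z \<omega> \<partial>Q)" by (rule integral_nonneg_AE)
  then show "W \<in> borel_measurable P" "integrable Q W" "(\<integral>\<omega>. W \<omega> \<partial>Q) \<le> 0"
    using Y' Z' by (simp_all add: W_eq)
qed

text \<open>Expectation under Q is L1(Q)-continuous and non-positive on the cone.\<close>

lemma L1_closure_integral_nonpos:
  assumes Q: "Q \<in> M1 P K" and G: "G \<in> L1_closure P Q (K_minus_L1_plus P K Q)"
  shows "(\<integral>\<omega>. G \<omega> \<partial>Q) \<le> 0"
proof -
  obtain W where W: "\<And>n. W n \<in> K_minus_L1_plus P K Q"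
    and lim: "(\<lambda>n. \<integral>\<^sup>+ \<omega>. ennreal \<bar>G \<omega> - W n \<omega>\<bar> \<partial>Q) \<longlonglongrightarrow> 0"
    and intG: "integrable Q G"
    using G by (auto simp: L1_closure_def L1_def)
  note W' = K_minus_L1_plus_integral_nonpos[OF Q W]
  have "(\<integral>\<^sup>+ \<omega>. ennreal (norm (W n \<omega> - G \<omega>)) \<partial>Q) = (\<integral>\<^sup>+ \<omega>. ennreal \<bar>G \<omega> - W n \<omega>\<bar> \<partial>Q)" for n
    by (simp add: abs_minus_commute)
  with lim have "(\<lambda>n. \<integral>\<omega>. W n \<omega> \<partial>Q) \<longlonglongrightarrow> (\<integral>\<omega>. G \<omega> \<partial>Q)"
    using W' intG by (intro tendsto_L1_int) auto
  then show ?thesis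
    using W'(3) by (intro LIMSEQ_le_const2) auto
qed

text \<open>Otherwise a separating Z at Q is turned into a measure R in \<open>M_Phi\<close> with
  positive expectation of Y, contradicting \<open>neg\<close>.\<close>

lemma in_L1_closure_if_integral_nonpos:
  assumes P: "prob_space P" and K: "wedge_L0 P K" and \<Phi>: "convex_Phi \<Phi>" "growth_condition \<Phi>"
    and Q: "Q \<in> M_Phi P K \<Phi>"
    and Y: "Y \<in> L1 P Q" and neg: "\<And>R. R \<in> M_Phi P K \<Phi> \<Longrightarrow> (\<integral>\<omega>. Y \<omega> \<partial>R) \<le> 0"
  shows "Y \<in> L1_closure P Q (K_minus_L1_plus P K Q)"
proof (rule ccontr)
  assume notin: "Y \<notin> L1_closure P Q (K_minus_L1_plus P K Q)"
  let ?C = "K_minus_L1_plus P K Q"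
  have Q1: "Q \<in> M1 P K" and Q': "prob_space Q" "sets Q = sets P" "K \<subseteq> L1 P Q"
    and QK: "\<And>X. X \<in> K \<Longrightarrow> (\<integral>\<omega>. X \<omega> \<partial>Q) \<le> 0"
    using Q by (auto simp: M_Phi_def M1_def)
  interpret Q: prob_space Q by fact
  have meas: "borel_measurable Q = borel_measurable P"
    using Q'(2) by (intro measurable_cong_sets) auto
  have intY [simp]: "integrable Q Y" using Y by (simp add: L1_def)
  have intC: "integrable Q W" if "W \<in> ?C" for W
    using K_minus_L1_plus_integral_nonpos(2)[OF Q1 that] .
  obtain X0 where X0: "X0 \<in> K" using K by (auto simp: wedge_L0_def)
  have zero: "(\<lambda>_. 0) \<in> K"
    using wedge_L0_scale[OF K X0, of 0] by simp
  have CI: "(\<lambda>\<omega>. X \<omega> - Z \<omega>) \<in> ?C" if "X \<in> K" "Z \<in> L1_plus P Q" for X Z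
    using that by (auto simp: K_minus_L1_plus_def)
  have add: "(\<lambda>\<omega>. V \<omega> + W \<omega>) \<in> ?C" if VW: "V \<in> ?C" "W \<in> ?C" for V W
  proof -
    obtain X1 Z1 X2 Z2 where eq: "V = (\<lambda>\<omega>. X1 \<omega> - Z1 \<omega>)" "W = (\<lambda>\<omega>. X2 \<omega> - Z2 \<omega>)"
      and XZ: "X1 \<in> K" "X2 \<in> K" "Z1 \<in> L1_plus P Q" "Z2 \<in> L1_plus P Q"
      using VW unfolding K_minus_L1_plus_def by blast
    have "(\<lambda>\<omega>. Z1 \<omega> + Z2 \<omega>) \<in> L1_plus P Q"
      using XZ by (auto simp: L1_plus_def L1_def)
    from CI[OF wedge_L0_add[OF K XZ(1,2)] this] show ?thesis
      by (simp add: eq algebra_simps)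
  qed
  have scale: "(\<lambda>\<omega>. c * W \<omega>) \<in> ?C" if cW: "0 \<le> c" "W \<in> ?C" for c W
  proof -
    obtain X1 Z1 where eq: "W = (\<lambda>\<omega>. X1 \<omega> - Z1 \<omega>)"
      and XZ: "X1 \<in> K" "Z1 \<in> L1_plus P Q"
      using cW unfolding K_minus_L1_plus_def by blast
    have "(\<lambda>\<omega>. c * Z1 \<omega>) \<in> L1_plus P Q"
      using XZ cW by (auto simp: L1_plus_def L1_def)
    moreover have "(\<lambda>\<omega>. c * X1 \<omega>) \<in> K"
      using wedge_L0_scale[OF K] XZ cW by blast
    ultimately show ?thesis
      using CI by (force simp add: eq algebra_simps)
  qed
  \<comment> \<open>Zero distance would supply elements of the cone within 1/(n+1) of Y, hence a
    sequence placing Y in the closure.\<close>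
  have "\<exists>\<delta>>0. \<forall>W\<in>?C. \<delta> \<le> (\<integral>\<omega>. \<bar>Y \<omega> - W \<omega>\<bar> \<partial>Q)"
  proof (rule ccontr)
    assume *: "\<not> ?thesis"
    have "\<exists>W\<in>?C. (\<integral>\<omega>. \<bar>Y \<omega> - W \<omega>\<bar> \<partial>Q) < 1 / real (Suc n)" for n
    proof (rule ccontr)
      assume "\<not> ?thesis"
      then have "\<forall>W\<in>?C. 1 / real (Suc n) \<le> (\<integral>\<omega>. \<bar>Y \<omega> - W \<omega>\<bar> \<partial>Q)"
        by (simp add: not_less)
      moreover have "0 < 1 / real (Suc n)" by simp
      ultimately show False using * by blast
    qed
    then obtain W where W: "\<And>n. W n \<in> ?C" "\<And>n. (\<integral>\<omega>. \<bar>Y \<omega> - W n \<omega>\<bar> \<partial>Q) < 1 / real (Suc n)"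
      by metis
    have "(\<lambda>n. \<integral>\<omega>. \<bar>Y \<omega> - W n \<omega>\<bar> \<partial>Q) \<longlonglongrightarrow> 0"
      by (rule tendsto_sandwich[OF _ _ tendsto_const LIMSEQ_Suc[OF lim_1_over_n]])
         (use W in \<open>auto intro!: always_eventually less_imp_le\<close>)
    then have "(\<lambda>n. ennreal (\<integral>\<omega>. \<bar>Y \<omega> - W n \<omega>\<bar> \<partial>Q)) \<longlonglongrightarrow> ennreal 0"
      by (rule tendsto_ennrealI)
    then have "(\<lambda>n. \<integral>\<^sup>+ \<omega>. ennreal \<bar>Y \<omega> - W n \<omega>\<bar> \<partial>Q) \<longlonglongrightarrow> 0"
      using intC[OF W(1)] by (subst nn_integral_eq_integral) auto
    then show False
      using notin Y W(1) by (auto simp: L1_closure_def)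
  qed
  then obtain \<delta> where \<delta>: "0 < \<delta>" "\<And>W. W \<in> ?C \<Longrightarrow> \<delta> \<le> (\<integral>\<omega>. \<bar>Y \<omega> - W \<omega>\<bar> \<partial>Q)"
    by blast
  have C_ne: "?C \<noteq> {}"
    using CI[OF zero, of "\<lambda>_. 0"] by (auto simp: L1_plus_def L1_def)
  have "\<exists>Z\<in>borel_measurable Q. (\<forall>x. \<bar>Z x\<bar> \<le> 1) \<and>
      (\<forall>V\<in>?C. (\<integral>x. Z x * V x \<partial>Q) \<le> 0) \<and> 0 < (\<integral>x. Z x * Y x \<partial>Q)"
    by (rule Q.L1_cone_separation) (fact intC C_ne add scale intY \<delta>)+
  then obtain Z where Z: "Z \<in> borel_measurable Q" "\<And>x. \<bar>Z x\<bar> \<le> 1"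
    and ZC: "\<And>V. V \<in> ?C \<Longrightarrow> (\<integral>x. Z x * V x \<partial>Q) \<le> 0" and ZY: "0 < (\<integral>x. Z x * Y x \<partial>Q)"
    by blast
  note [measurable] = Z(1)
  have int_mult: "integrable Q (\<lambda>x. Z x * f x)" if "integrable Q f" for f
    using that Z by (rule integrable_mult_bounded)
  have intZ: "integrable Q Z"
    using int_mult[of "\<lambda>_. 1"] by simp
  have Z_nonneg: "AE x in Q. 0 \<le> Z x"
  proof -
    \<comment> \<open>The negative part of Z is the test payoff: as 0 lies in K, its negative is in
      the cone, and pairing it with Z gives the integral of its square.\<close>
    let ?N = "\<lambda>x. max 0 (- Z x)"
    have intN: "integrable Q ?N" using intZ by (intro integrable_max) auto
    then have "?N \<in> L1_plus P Q" using Z(1) meas by (auto simp: L1_plus_def L1_def)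
    from ZC[OF CI[OF zero this]] have "(\<integral>x. Z x * (0 - ?N x) \<partial>Q) \<le> 0" .
    moreover have sq: "Z x * (0 - ?N x) = (?N x)\<^sup>2" for x
      by (simp add: max_def power2_eq_square)
    ultimately have "(\<integral>x. (?N x)\<^sup>2 \<partial>Q) \<le> 0" by (simp only: sq)
    moreover have int2: "integrable Q (\<lambda>x. (?N x)\<^sup>2)"
      using int_mult[of "\<lambda>x. 0 - ?N x"] intN unfolding sq by simp
    ultimately have "(\<integral>x. (?N x)\<^sup>2 \<partial>Q) = 0"
      by (intro antisym integral_nonneg_AE) auto
    then have "AE x in Q. (?N x)\<^sup>2 = 0"
      using int2 by (subst (asm) integral_nonneg_eq_0_iff_AE) auto
    then show ?thesis by eventually_elim (auto simp: max_def split: if_splits)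
  qed
  \<comment> \<open>Small enough that \<epsilon> times |E Y| stays below half of E(Z Y); the added 1
    avoids division by zero when E Y = 0.\<close>
  define \<epsilon> where "\<epsilon> = (\<integral>x. Z x * Y x \<partial>Q) / (2 * (\<bar>\<integral>x. Y x \<partial>Q\<bar> + 1))"
  have \<epsilon>: "0 < \<epsilon>" using ZY by (auto simp: \<epsilon>_def)
  have \<epsilon>Y: "0 < (\<integral>x. Z x * Y x \<partial>Q) + \<epsilon> * (\<integral>x. Y x \<partial>Q)"
  proof -
    have "\<epsilon> * \<bar>\<integral>x. Y x \<partial>Q\<bar> < \<epsilon> * (2 * (\<bar>\<integral>x. Y x \<partial>Q\<bar> + 1))"
      using \<epsilon> by (intro mult_strict_left_mono) auto
    also have "\<dots> = (\<integral>x. Z x * Y x \<partial>Q)"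
      unfolding \<epsilon>_def by simp
    finally show ?thesis
      using \<epsilon> mult_left_mono[of "- \<bar>\<integral>x. Y x \<partial>Q\<bar>" "\<integral>x. Y x \<partial>Q" \<epsilon>]
      by (simp add: abs_ge_minus_self minus_le_iff)
  qed
  define c where "c = (\<integral>x. Z x \<partial>Q) + \<epsilon>"
  have c: "0 < c"
    using integral_nonneg_AE[OF Z_nonneg] \<epsilon> by (simp add: c_def)
  \<comment> \<open>Z is non-negative only Q-a.s.; \<open>max 0\<close> secures the lower bound
    \<epsilon>/c at every point, as \<open>density_in_M_Phi\<close> demands.\<close>
  define g where "g x = (max 0 (Z x) + \<epsilon>) / c" for x
  have g_meas: "g \<in> borel_measurable Q" unfolding g_def by measurable
  have g_nonneg: "0 \<le> g x" for x
    using \<epsilon> c by (simp add: g_def)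
  have g_int: "(\<integral>x. g x * f x \<partial>Q) = ((\<integral>x. Z x * f x \<partial>Q) + \<epsilon> * (\<integral>x. f x \<partial>Q)) / c"
    if f: "integrable Q f" for f
  proof -
    have [measurable]: "f \<in> borel_measurable Q" using f by simp
    have "(\<integral>x. g x * f x \<partial>Q) = (\<integral>x. (Z x * f x + \<epsilon> * f x) / c \<partial>Q)"
    proof (rule integral_cong_AE)
      show "AE x in Q. g x * f x = (Z x * f x + \<epsilon> * f x) / c"
        using Z_nonneg by eventually_elim (simp add: g_def field_simps)
    qed (simp_all add: g_def)
    also have "\<dots> = ((\<integral>x. Z x * f x \<partial>Q) + \<epsilon> * (\<integral>x. f x \<partial>Q)) / c"
      using int_mult[OF f] f by simp
    finally show ?thesis .
  qed
  have "density Q (\<lambda>x. ennreal (g x)) \<in> M_Phi P K \<Phi>"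
  proof (rule density_in_M_Phi[OF P \<Phi> Q])
    show "g \<in> borel_measurable P" using g_meas by (simp only: meas)
    show "0 < \<epsilon> / c" using \<epsilon> c by simp
    show "\<epsilon> / c \<le> g x" "g x \<le> (1 + \<epsilon>) / c" for x
      using c Z(2)[of x] by (auto simp: g_def intro!: divide_right_mono)
    show "(\<integral>x. g x \<partial>Q) = 1"
      using g_int[of "\<lambda>_. 1"] c by (simp add: Q.prob_space c_def)
    fix X assume X: "X \<in> K"
    \<comment> \<open>Both parts of g price X non-positively: Z because X lies in the cone, the
      constant \<epsilon> because Q is in \<open>M1\<close>.\<close>
    have "(\<lambda>\<omega>. X \<omega> - 0) \<in> ?C"
      using CI[OF X, of "\<lambda>_. 0"] by (auto simp: L1_plus_def L1_def)
    then have "(\<integral>x. Z x * X x \<partial>Q) \<le> 0" using ZC by force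
    moreover have "integrable Q X" using X Q' by (auto simp: L1_def)
    ultimately show "(\<integral>x. g x * X x \<partial>Q) \<le> 0"
      using QK[OF X] \<epsilon> c g_int by (simp add: divide_le_0_iff mult_nonneg_nonpos add_nonpos_nonpos)
  qed
  from neg[OF this] have "(\<integral>x. g x * Y x \<partial>Q) \<le> 0"
    by (subst (asm) integral_density[OF borel_measurable_integrable[OF intY] g_meas])
       (simp_all add: g_nonneg)
  with g_int[OF intY] \<epsilon>Y c show False
    by (simp add: divide_le_0_iff)
qed

section \<open>Superhedging duality\<close>

theorem corollary6p5:
  fixes P :: "'a measure" and K :: "('a \<Rightarrow> real) set"
    and \<Phi> :: "real \<Rightarrow> ereal" and X :: "'a \<Rightarrow> real"
  assumes "prob_space P"
    and "wedge_L0 P K"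
    and "convex_Phi \<Phi>"
    and "X \<in> E_Phi P K \<Phi>"
    and "growth_condition \<Phi>"
    and "M_Phi P K \<Phi> \<noteq> {}"
  shows "superhedging_price P (C_Phi P K \<Phi>) X =
    (SUP Q\<in>M_Phi P K \<Phi>. ereal (\<integral>\<omega>. X \<omega> \<partial>Q))"
    (is "?\<pi> = ?s")
proof (rule antisym)
  have M: "Q \<in> M1 P K" "prob_space Q" "absolutely_continuous P Q" "sets Q = sets P" "X \<in> L1 P Q"
    if "Q \<in> M_Phi P K \<Phi>" for Q
    using that assms(4) by (auto simp: M_Phi_def M1_def E_Phi_def)
  show "?s \<le> ?\<pi>"
    unfolding superhedging_price_def
  proof (intro SUP_least Inf_greatest, clarify)
    fix Q x G
    assume Q: "Q \<in> M_Phi P K \<Phi>" and G: "G \<in> C_Phi P K \<Phi>" and le: "AE \<omega> in P. X \<omega> \<le> x + G \<omega>"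
    interpret Q: prob_space Q using M[OF Q] by simp
    have G': "G \<in> L1_closure P Q (K_minus_L1_plus P K Q)"
      using G Q by (auto simp: C_Phi_def)
    then have intG: "integrable Q G" by (auto simp: L1_closure_def L1_def)
    have "AE \<omega> in Q. X \<omega> \<le> x + G \<omega>"
      using M[OF Q] le by (auto intro: absolutely_continuous_AE)
    then have "(\<integral>\<omega>. X \<omega> \<partial>Q) \<le> (\<integral>\<omega>. x + G \<omega> \<partial>Q)"
      using M[OF Q] intG by (intro integral_mono_AE) (auto simp: L1_def)
    also have "\<dots> \<le> x"
      using intG L1_closure_integral_nonpos[OF M(1)[OF Q] G'] by (simp add: Q.prob_space)
    finally show "ereal (\<integral>\<omega>. X \<omega> \<partial>Q) \<le> ereal x" by simp
  qed
  show "?\<pi> \<le> ?s"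
  proof (cases ?s)
    case (real s)
    \<comment> \<open>X - s itself serves as the hedge G: it lies in the closure for every Q at
      once, so the price s is admissible.\<close>
    let ?Y = "\<lambda>\<omega>. X \<omega> - s"
    have "?Y \<in> L1_closure P Q (K_minus_L1_plus P K Q)" if Q: "Q \<in> M_Phi P K \<Phi>" for Q
    proof (rule in_L1_closure_if_integral_nonpos[OF assms(1-3,5) Q])
      interpret Q: prob_space Q using M[OF Q] by simp
      show "?Y \<in> L1 P Q" using M(5)[OF Q] by (auto simp: L1_def)
      fix R assume R: "R \<in> M_Phi P K \<Phi>"
      interpret R: prob_space R using M[OF R] by simp
      have "ereal (\<integral>\<omega>. X \<omega> \<partial>R) \<le> ereal s"
        unfolding real[symmetric] using R by (rule SUP_upper)
      then show "(\<integral>\<omega>. ?Y \<omega> \<partial>R) \<le> 0"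
        using M(5)[OF R] by (simp add: L1_def R.prob_space)
    qed
    then have "?Y \<in> C_Phi P K \<Phi>" by (auto simp: C_Phi_def)
    then show ?thesis
      unfolding superhedging_price_def real by (intro Inf_lower CollectI exI[of _ s]) force
  next
    case PInf
    then show ?thesis by simp
  next
    \<comment> \<open>Impossible: \<open>M_Phi\<close> is non-empty, and each expectation in the
      supremum is a real number.\<close>
    case MInf
    obtain Q where "Q \<in> M_Phi P K \<Phi>" using assms(6) by auto
    then have "ereal (\<integral>\<omega>. X \<omega> \<partial>Q) \<le> ?s" by (rule SUP_upper)
    with MInf show ?thesis by simp
  qed
qed

end
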